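(* For all integers $g\ge1$ and $n\ge1$, $H^\sim_{g,n}=H_{g,n}$.
   Context: Complex origami counts. - For $\lambda\vdash n$ let $C_\lambda\subset S_n$ be the conjugacy class of cycle type $\lambda$. - Let $h^\circ_{\lambda,n}=\frac{1}{n!}\#\{(\sigma,\rho)\in S_n\times S_n:\sigma\rho\sigma^{-1}\rho^{-1}\in C_\lambda\}$. - Define $h_{\lambda,n}$ as the coefficients of the logarithm $$\log\Bigl(\sum_{n\ge0}\sum_{\lambda\vdash n}h^\circ_{\lambda,n}p_\lambda t^n\Bigr)=\sum_{n\ge1}\sum_{\lambda\vdash n}h_{\lambda,n}p_\lambda t^n,$$ where $p_\lambda=\prod_i p_{\lambda_i}$ are products of formal power-sum variables. - Put $H_{g,n}=\sum_{\lambda\vdash n,\ \ell(\lambda)=n+2-2g}h_{\lambda,n}$, where $\ell(\lambda)$ is the number of parts of $\lambda$. This is the weighted number of connected origami of degree $n$ and genus $g$. Monotone double Hurwitz numbers. - A sequence of transpositions $\tau_i=(a_i,b_i)$ with $a_i<b_i$ is strictly monotone if $b_i<b_{i+1}$ for all $i$. - Define $$H^\sim_{g,n}=\frac{1}{n!}\#\{(\sigma,\rho,\tau_1,\dots,\tau_{2g-2})\},$$ counting tuples such that: $\sigma,\rho\in S_n$; each $\tau_i\in S_n$ is a transposition; $(\tau_1,\dots,\tau_{2g-2})$ is strictly monotone; $\sigma\rho\sigma^{-1}\rho^{-1}\tau_1\cdots\tau_{2g-2}=\mathrm{id}$; and the group $\langle\tau_1,\dots,\tau_{2g-2},\sigma,\rho\rangle$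 acts transitively on $\{1,\dots,n\}$. *)

theory Defs
  imports Complex_Main "HOL-Combinatorics.Combinatorics" "HOL-Library.Multiset"
begin

definition cycle_type :: "nat \<Rightarrow> (nat \<Rightarrow> nat) \<Rightarrow> nat multiset" where
  "cycle_type n \<sigma> = image_mset card (mset_set ((\<lambda>x. orbit \<sigma> x) ` {1..n}))"

definition commutator :: "(nat \<Rightarrow> nat) \<Rightarrow> (nat \<Rightarrow> nat) \<Rightarrow> (nat \<Rightarrow> nat)" where
  "commutator \<sigma> \<rho> = \<sigma> \<circ> \<rho> \<circ> inv \<sigma> \<circ> inv \<rho>"

definition hcirc :: "nat multiset \<Rightarrow> real" where
  "hcirc lam = (let n = sum_mset lam in
     real (card {(\<sigma>, \<rho>). \<sigma> permutes {1..n} \<and> \<rho> permutes {1..n}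
                  \<and> cycle_type n (commutator \<sigma> \<rho>) = lam}) / fact n)"

text \<open>The generating series sum h-circ_{lambda,n} p_lambda t^n is the formal series
  F whose coefficient of the monomial p_lambda t^{|lambda|} is hcirc lambda
  (t-degree equals |lambda|); its constant term is hcirc {#} = 1.
  log F = sum_{k>=1} (-1)^(k+1)/k (F-1)^k; the coefficient of p_lambda in (F-1)^k
  is the sum over ordered k-tuples of nonempty monomials multiplying to p_lambda.\<close>
definition ordered_factorisations :: "nat multiset \<Rightarrow> nat multiset list set" where
  "ordered_factorisations lam = {ms. (\<forall>\<mu>\<in>set ms. \<mu> \<noteq> {#}) \<and> sum_list ms = lam}"

definition hcoef :: "nat multiset \<Rightarrow> real" where
  "hcoef lam = (\<Sum>ms\<in>ordered_factorisations lam.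
      (-1) ^ (length ms + 1) / real (length ms) * (\<Prod>\<mu>\<leftarrow>ms. hcirc \<mu>))"

definition partitions_of :: "nat \<Rightarrow> nat multiset set" where
  "partitions_of n = {lam. (\<forall>x\<in>#lam. 0 < x) \<and> sum_mset lam = n}"

definition H :: "nat \<Rightarrow> nat \<Rightarrow> real" where
  "H g n = (\<Sum>lam\<in>{lam\<in>partitions_of n. int (size lam) = int n + 2 - 2 * int g}. hcoef lam)"

inductive_set gen_group :: "(nat \<Rightarrow> nat) set \<Rightarrow> (nat \<Rightarrow> nat) set" for S where
  gen_id: "id \<in> gen_group S"
| gen_base: "f \<in> S \<Longrightarrow> f \<in> gen_group S"
| gen_comp: "f \<in> gen_group S \<Longrightarrow> g \<in> gen_group S \<Longrightarrow> f \<circ> g \<in> gen_group S"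
| gen_inv: "f \<in> gen_group S \<Longrightarrow> inv f \<in> gen_group S"

text \<open>A transposition tau_i = (a_i,b_i), a_i < b_i, is recorded by the pair (a_i,b_i).\<close>
definition strictly_monotone :: "(nat \<times> nat) list \<Rightarrow> bool" where
  "strictly_monotone ts = (\<forall>i. Suc i < length ts \<longrightarrow> snd (ts ! i) < snd (ts ! Suc i))"

definition Htilde :: "nat \<Rightarrow> nat \<Rightarrow> real" where
  "Htilde g n = real (card {(\<sigma>, \<rho>, ts).
       \<sigma> permutes {1..n} \<and> \<rho> permutes {1..n}
     \<and> length ts = 2 * g - 2
     \<and> (\<forall>(a, b)\<in>set ts. 1 \<le> a \<and> a < b \<and> b \<le> n)
     \<and> strictly_monotone ts
     \<and> commutator \<sigma> \<rho> \<circ> foldr (\<lambda>(a, b) f. transpose a b \<circ> f) ts id = id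
     \<and> (\<forall>x\<in>{1..n}. \<forall>y\<in>{1..n}. \<exists>f\<in>gen_group ({\<sigma>, \<rho>} \<union> (\<lambda>(a, b). transpose a b) ` set ts). f x = y)})
     / fact n"

end

theory Submission
  imports Defs
begin

text \<open>Both sides count the pairs \<open>(\<sigma>, \<rho>)\<close> of permutations that generate a transitive group and whose
  commutator has \<open>n + 2 - 2 g\<close> cycles.

  For \<open>H\<close> this is the exponential formula. Let \<open>f(\<lambda>)\<close> and \<open>c(\<lambda>)\<close> be the normalised counts of all
  pairs and of transitive pairs whose commutator has cycle type \<open>\<lambda>\<close>. Marking a point and splitting
  a pair at the component of that point gives \<open>|\<lambda>| f(\<lambda>) = \<Sum> |\<mu>| c(\<mu>) f(\<lambda> - \<mu>)\<close>, summed over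
  \<open>\<mu> \<subseteq> \<lambda>\<close>. The coefficients of the logarithm of the series of \<open>f\<close> satisfy the same recursion, which
  determines them.

  For \<open>Htilde\<close>, every permutation has exactly one strictly monotone factorisation into transpositions
  (Jucys). Its length is \<open>n\<close> minus the number of cycles, and its factors preserve every set preserved
  by the permutation, so adjoining them to \<open>\<sigma>\<close> and \<open>\<rho>\<close> does not affect transitivity.\<close>

section \<open>Coefficients of the logarithm\<close>

lemma finite_subseteq_mset: "finite {\<mu>. \<mu> \<subseteq># lam}"
proof (rule finite_subset)
  show "{\<mu>. \<mu> \<subseteq># lam} \<subseteq> (\<Union>k\<le>size lam. multisets_of_size (set_mset lam) k)"
    by (auto simp: multisets_of_size_def size_mset_mono dest: mset_subset_eqD)
qed (simp add: finite_multisets_of_size)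

lemma finite_subset_mset: "finite {\<mu>. \<mu> \<subset># lam}"
  by (rule finite_subset[OF _ finite_subseteq_mset[of lam]]) (auto simp: subset_mset.less_imp_le)

lemma sum_subseteq_mset_eq:
  fixes g :: "'a multiset \<Rightarrow> 'b::comm_monoid_add"
  shows "(\<Sum>\<mu> | \<mu> \<subseteq># lam. g \<mu>) = g lam + (\<Sum>\<mu> | \<mu> \<subset># lam. g \<mu>)"
proof -
  have "{\<mu>. \<mu> \<subseteq># lam} = insert lam {\<mu>. \<mu> \<subset># lam}"
    by (auto simp: subset_mset.le_less)
  then show ?thesis by (simp add: finite_subset_mset)
qed

lemma finite_ordered_factorisations: "finite (ordered_factorisations lam)"
proof (rule finite_subset)
  show "ordered_factorisations lam \<subseteq> {ms. set ms \<subseteq> {\<mu>. \<mu> \<subseteq># lam} \<and> length ms \<le> size lam}"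
  proof
    fix ms assume "ms \<in> ordered_factorisations lam"
    then have nonempty: "\<forall>\<mu>\<in>set ms. \<mu> \<noteq> {#}" and sum: "sum_list ms = lam"
      by (auto simp: ordered_factorisations_def)
    have "set ms \<subseteq> {\<mu>. \<mu> \<subseteq># sum_list ms}"
      by (induction ms) (auto intro: subset_mset.order_trans)
    moreover have "length ms \<le> size (sum_list ms)" using nonempty
    proof (induction ms)
      case (Cons \<mu> ms)
      then have "0 < size \<mu>" by (simp add: nonempty_has_size)
      then show ?case using Cons by fastforce
    qed simp
    ultimately show "ms \<in> {ms. set ms \<subseteq> {\<mu>. \<mu> \<subseteq># lam} \<and> length ms \<le> size lam}"
      using sum by auto
  qed
qed (intro finite_lists_length_le finite_subseteq_mset)

lemma ordered_factorisations_empty: "ordered_factorisations {#} = {[]}"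
proof -
  have "ms = []" if "\<forall>\<mu>\<in>set ms. \<mu> \<noteq> {#}" "sum_list ms = {#}" for ms :: "nat multiset list"
    using that by (cases ms) auto
  then show ?thesis by (auto simp: ordered_factorisations_def)
qed

lemma bij_betw_ordered_factorisations_snoc:
  "bij_betw (\<lambda>(\<mu>, ms). ms @ [lam - \<mu>]) (SIGMA \<mu>:{\<mu>. \<mu> \<subset># lam}. ordered_factorisations \<mu>)
    (ordered_factorisations lam - {[]})"
proof (rule bij_betw_byWitness[where f' = "\<lambda>ms. (sum_list (butlast ms), butlast ms)"])
  let ?S = "SIGMA \<mu>:{\<mu>. \<mu> \<subset># lam}. ordered_factorisations \<mu>"
  have decompose: "\<exists>ns \<nu>. ms = ns @ [\<nu>] \<and> ns \<in> ordered_factorisations (sum_list ns) \<and> \<nu> \<noteq> {#}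
      \<and> sum_list ns + \<nu> = lam"
    if "ms \<in> ordered_factorisations lam - {[]}" for ms
    using that by (cases ms rule: rev_cases) (auto simp: ordered_factorisations_def)
  show "\<forall>ms\<in>ordered_factorisations lam - {[]}.
      (\<lambda>(\<mu>, ms). ms @ [lam - \<mu>]) (sum_list (butlast ms), butlast ms) = ms"
    using decompose by fastforce
  show "(\<lambda>ms. (sum_list (butlast ms), butlast ms)) ` (ordered_factorisations lam - {[]}) \<subseteq> ?S"
    using decompose by (fastforce simp: subset_mset.less_le)
  show "(\<lambda>(\<mu>, ms). ms @ [lam - \<mu>]) ` ?S \<subseteq> ordered_factorisations lam - {[]}"
  proof clarsimp
    fix \<mu> ms assume proper: "\<mu> \<subset># lam" and ms: "ms \<in> ordered_factorisations \<mu>"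
    have "\<mu> + (lam - \<mu>) = lam" "lam - \<mu> \<noteq> {#}"
      using proper
      by (simp_all add: subset_mset.less_imp_le Diff_eq_empty_iff_mset subset_mset.less_le_not_le[THEN iffD1])
    then show "ms @ [lam - \<mu>] \<in> ordered_factorisations lam"
      using ms by (auto simp: ordered_factorisations_def)
  qed
qed (auto simp: ordered_factorisations_def)

lemma mset_rotate [simp]: "mset (rotate i xs) = mset xs"
  by (metis append_take_drop_id mset_append rotate_drop_take union_commute)

lemma sum_list_weights_eq_head_weights:
  fixes g :: "'a list \<Rightarrow> 'b::comm_semiring_1"
  assumes "finite X" and rotate_mem: "\<And>xs i. xs \<in> X \<Longrightarrow> rotate i xs \<in> X"
    and rotate_g: "\<And>xs i. g (rotate i xs) = g xs"
  shows "(\<Sum>xs\<in>X. g xs * sum_list (map w xs)) = (\<Sum>xs\<in>X. of_nat (length xs) * (g xs * w (hd xs)))"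
proof -
  let ?S = "SIGMA xs:X. {..<length xs}"
  have hd_rotate: "hd (rotate i xs) = xs ! i" if "i < length xs" for xs :: "'a list" and i
    using that by (subst hd_rotate_conv_nth) auto
  have "(\<Sum>xs\<in>X. g xs * sum_list (map w xs)) = (\<Sum>xs\<in>X. \<Sum>i<length xs. g xs * w (xs ! i))"
    by (simp add: sum_list_sum_nth atLeast0LessThan sum_distrib_left)
  also have "\<dots> = (\<Sum>(xs, i)\<in>?S. g xs * w (xs ! i))"
    using assms(1) by (simp add: sum.Sigma)
  also have "\<dots> = (\<Sum>(xs, i)\<in>?S. g xs * w (hd xs))"
    by (rule sum.reindex_bij_witness[where j = "\<lambda>(xs, i). (rotate i xs, i)"
          and i = "\<lambda>(xs, i). (rotate (length xs - i) xs, i)"])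
      (auto simp: rotate_mem rotate_g rotate_rotate hd_rotate)
  also have "\<dots> = (\<Sum>xs\<in>X. \<Sum>i<length xs. g xs * w (hd xs))"
    using assms(1) by (intro sum.Sigma[symmetric]) auto
  finally show ?thesis by simp
qed

definition log_coeff :: "(nat multiset \<Rightarrow> 'a) \<Rightarrow> nat multiset \<Rightarrow> 'a::field_char_0" where
  "log_coeff f lam = (\<Sum>ms\<in>ordered_factorisations lam.
      (-1) ^ (length ms + 1) / of_nat (length ms) * (\<Prod>\<mu>\<leftarrow>ms. f \<mu>))"

lemma hcoef_eq_log_coeff: "hcoef = log_coeff hcirc"
  by (simp add: fun_eq_iff hcoef_def log_coeff_def)

primrec signed_head_weight :: "('a \<Rightarrow> 'b) \<Rightarrow> ('a \<Rightarrow> 'b) \<Rightarrow> 'a list \<Rightarrow> 'b::comm_ring_1" where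
  "signed_head_weight w f [] = 0"
| "signed_head_weight w f (x # xs) = w x * f x * (\<Prod>y\<leftarrow>xs. - f y)"

lemma signed_head_weight_snoc:
  "signed_head_weight w f (xs @ [x]) =
    (if xs = [] then w x * f x else - (signed_head_weight w f xs * f x))"
  by (cases xs) (simp_all add: mult.assoc)

text \<open>Averaging over the cyclic rotations of a factorisation turns its total weight divided by its
  length into the weight of its first factor.\<close>
lemma weight_times_log_coeff:
  fixes w f :: "nat multiset \<Rightarrow> 'a::field_char_0"
  assumes add: "\<And>\<mu> \<nu>. w (\<mu> + \<nu>) = w \<mu> + w \<nu>"
  shows "w lam * log_coeff f lam = (\<Sum>ms\<in>ordered_factorisations lam. signed_head_weight w f ms)"
proof -
  define g where "g ms = (-1) ^ (length ms + 1) / of_nat (length ms) * (\<Prod>\<mu>\<leftarrow>ms. f \<mu>)" for ms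
  have "w {#} = 0" using add[of "{#}" "{#}"] by simp
  then have weight: "w (sum_list ms) = sum_list (map w ms)" for ms
    by (induction ms) (simp_all add: add)
  have "w lam * log_coeff f lam = (\<Sum>ms\<in>ordered_factorisations lam. g ms * sum_list (map w ms))"
    unfolding log_coeff_def sum_distrib_left g_def
    by (intro sum.cong) (auto simp: ordered_factorisations_def simp flip: weight)
  also have "\<dots> = (\<Sum>ms\<in>ordered_factorisations lam. of_nat (length ms) * (g ms * w (hd ms)))"
  proof (rule sum_list_weights_eq_head_weights)
    show "rotate i ms \<in> ordered_factorisations lam" if "ms \<in> ordered_factorisations lam" for ms i
      using that by (simp add: ordered_factorisations_def flip: sum_mset_sum_list)
    show "g (rotate i ms) = g ms" for ms i
      by (simp add: g_def rotate_map flip: prod_mset_prod_list)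
  qed (rule finite_ordered_factorisations)
  also have "\<dots> = (\<Sum>ms\<in>ordered_factorisations lam. signed_head_weight w f ms)"
  proof (rule sum.cong)
    have "(\<Prod>\<mu>\<leftarrow>ms. - f \<mu>) = (-1) ^ length ms * (\<Prod>\<mu>\<leftarrow>ms. f \<mu>)" for ms
      by (induction ms) (simp_all add: algebra_simps)
    then show "of_nat (length ms) * (g ms * w (hd ms)) = signed_head_weight w f ms" for ms
      by (cases ms) (simp_all add: g_def field_simps del: of_nat_Suc)
  qed simp
  finally show ?thesis .
qed

text \<open>Every nonempty factorisation arises from a shorter one by appending a last factor, which
  reverses its sign.\<close>
lemma log_coeff_recursion:
  fixes w f :: "nat multiset \<Rightarrow> 'a::field_char_0"
  assumes add: "\<And>\<mu> \<nu>. w (\<mu> + \<nu>) = w \<mu> + w \<nu>" and f_empty: "f {#} = 1"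
  shows "w lam * f lam = (\<Sum>\<mu> | \<mu> \<subseteq># lam. w \<mu> * log_coeff f \<mu> * f (lam - \<mu>))"
proof -
  let ?O = ordered_factorisations and ?s = "signed_head_weight w f"
  have w_empty: "w {#} = 0" using add[of "{#}" "{#}"] by simp
  have snoc: "(\<Sum>ms\<in>?O \<mu>. ?s (ms @ [\<nu>])) =
      (if \<mu> = {#} then w \<nu> * f \<nu> else 0) - w \<mu> * log_coeff f \<mu> * f \<nu>" for \<mu> \<nu>
  proof (cases "\<mu> = {#}")
    case True
    then show ?thesis by (simp add: ordered_factorisations_empty w_empty)
  next
    case False
    then have "ms \<noteq> []" if "ms \<in> ?O \<mu>" for ms
      using that by (auto simp: ordered_factorisations_def)
    then have "(\<Sum>ms\<in>?O \<mu>. ?s (ms @ [\<nu>])) = (\<Sum>ms\<in>?O \<mu>. - (?s ms * f \<nu>))"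
      by (intro sum.cong) (auto simp: signed_head_weight_snoc)
    then show ?thesis
      using False by (simp add: weight_times_log_coeff[OF add] sum_negf sum_distrib_right)
  qed
  have "w lam * log_coeff f lam = sum ?s (?O lam - {[]})"
    unfolding weight_times_log_coeff[OF add]
    by (rule sum.mono_neutral_right) (auto simp: finite_ordered_factorisations)
  also have "\<dots> = (\<Sum>(\<mu>, ms)\<in>(SIGMA \<mu>:{\<mu>. \<mu> \<subset># lam}. ?O \<mu>). ?s (ms @ [lam - \<mu>]))"
    unfolding sum.reindex_bij_betw[OF bij_betw_ordered_factorisations_snoc, symmetric]
    by (simp add: case_prod_beta)
  also have "\<dots> = (\<Sum>\<mu> | \<mu> \<subset># lam. \<Sum>ms\<in>?O \<mu>. ?s (ms @ [lam - \<mu>]))"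
    by (simp add: sum.Sigma finite_subset_mset finite_ordered_factorisations)
  also have "\<dots> = (\<Sum>\<mu> | \<mu> \<subset># lam. if \<mu> = {#} then w lam * f lam else 0) -
      (\<Sum>\<mu> | \<mu> \<subset># lam. w \<mu> * log_coeff f \<mu> * f (lam - \<mu>))"
    unfolding snoc sum_subtractf by (auto intro!: sum.cong)
  also have "(\<Sum>\<mu> | \<mu> \<subset># lam. if \<mu> = {#} then w lam * f lam else 0) = w lam * f lam"
    by (cases "lam = {#}") (simp_all add: w_empty finite_subset_mset subset_mset.zero_less_iff_neq_zero)
  finally show ?thesis by (simp add: sum_subseteq_mset_eq f_empty)
qed

lemma log_coeff_unique:
  fixes w f c :: "nat multiset \<Rightarrow> 'a::field_char_0"
  assumes add: "\<And>\<mu> \<nu>. w (\<mu> + \<nu>) = w \<mu> + w \<nu>" and f_empty: "f {#} = 1"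
    and recursion: "\<And>lam. w lam * f lam = (\<Sum>\<mu> | \<mu> \<subseteq># lam. w \<mu> * c \<mu> * f (lam - \<mu>))"
  shows "w lam * log_coeff f lam = w lam * c lam"
proof (induction lam rule: measure_induct_rule[of size])
  case (less lam)
  have "(\<Sum>\<mu> | \<mu> \<subseteq># lam. w \<mu> * log_coeff f \<mu> * f (lam - \<mu>)) =
      (\<Sum>\<mu> | \<mu> \<subseteq># lam. w \<mu> * c \<mu> * f (lam - \<mu>))"
    using log_coeff_recursion[of w f lam, OF add f_empty] recursion[of lam] by simp
  moreover have "(\<Sum>\<mu> | \<mu> \<subset># lam. w \<mu> * log_coeff f \<mu> * f (lam - \<mu>)) =
      (\<Sum>\<mu> | \<mu> \<subset># lam. w \<mu> * c \<mu> * f (lam - \<mu>))"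
    by (intro sum.cong refl) (simp add: less mset_subset_size)
  ultimately show ?case by (simp add: sum_subseteq_mset_eq f_empty)
qed

section \<open>Components of a set of permutations\<close>

definition invariant_under :: "('a \<Rightarrow> 'a) set \<Rightarrow> 'a set \<Rightarrow> bool" where
  "invariant_under S E \<longleftrightarrow> (\<forall>s\<in>S. s ` E = E)"

definition irreducible_on :: "('a \<Rightarrow> 'a) set \<Rightarrow> 'a set \<Rightarrow> bool" where
  "irreducible_on S B \<longleftrightarrow> (\<forall>E\<subseteq>B. invariant_under S E \<longrightarrow> E = {} \<or> E = B)"

definition components :: "('a \<Rightarrow> 'a) set \<Rightarrow> 'a set \<Rightarrow> 'a set set" where
  "components S A = {B. B \<subseteq> A \<and> B \<noteq> {} \<and> invariant_under S B \<and> irreducible_on S B}"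

definition gen_orbit :: "(nat \<Rightarrow> nat) set \<Rightarrow> nat \<Rightarrow> nat set" where
  "gen_orbit S x = (\<lambda>f. f x) ` gen_group S"

lemma invariant_under_permutes: "(\<And>s. s \<in> S \<Longrightarrow> s permutes A) \<Longrightarrow> invariant_under S A"
  by (simp add: invariant_under_def permutes_image)

lemma invariant_under_Int:
  assumes "\<And>s. s \<in> S \<Longrightarrow> inj s" "invariant_under S A" "invariant_under S B"
  shows "invariant_under S (A \<inter> B)"
  using assms by (simp add: invariant_under_def image_Int)

lemma gen_group_bij:
  assumes "f \<in> gen_group S" "\<And>s. s \<in> S \<Longrightarrow> bij s"
  shows "bij f"
  using assms(1) by induction (simp_all only: assms(2) bij_id bij_comp bij_imp_bij_inv)

lemma gen_group_image_eq:
  assumes "f \<in> gen_group S" and bij: "\<And>s. s \<in> S \<Longrightarrow> bij s" and invariant: "invariant_under S E"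
  shows "f ` E = E"
  using assms(1)
proof induction
  case (gen_comp f g)
  then show ?case by (metis image_comp)
next
  case (gen_inv f)
  have "inv f ` f ` E = E"
    using gen_group_bij[OF gen_inv.hyps bij] by (simp add: bij_is_inj image_inv_f_f)
  then show ?case using gen_inv.IH by simp
qed (use invariant in \<open>simp_all add: invariant_under_def\<close>)

lemma mem_gen_orbit_self: "x \<in> gen_orbit S x"
  unfolding gen_orbit_def by (rule image_eqI[OF _ gen_id]) simp

lemma gen_orbit_closed:
  assumes "f \<in> gen_group S" "y \<in> gen_orbit S x"
  shows "f y \<in> gen_orbit S x"
proof -
  obtain g where "g \<in> gen_group S" "y = g x" using assms(2) by (auto simp: gen_orbit_def)
  then show ?thesis
    unfolding gen_orbit_def by (intro image_eqI[OF _ gen_comp[OF assms(1)]]) auto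
qed

lemma gen_orbit_subset:
  assumes "\<And>s. s \<in> S \<Longrightarrow> bij s" "invariant_under S E" "x \<in> E"
  shows "gen_orbit S x \<subseteq> E"
  unfolding gen_orbit_def using gen_group_image_eq[OF _ assms(1,2)] assms(3) by blast

lemma invariant_under_gen_orbit:
  assumes bij: "\<And>s. s \<in> S \<Longrightarrow> bij s"
  shows "invariant_under S (gen_orbit S x)"
  unfolding invariant_under_def
proof (intro ballI equalityI subsetI)
  fix s y assume s: "s \<in> S"
  show "y \<in> gen_orbit S x" if "y \<in> s ` gen_orbit S x"
    using that gen_orbit_closed[OF gen_base[OF s]] by blast
  show "y \<in> s ` gen_orbit S x" if "y \<in> gen_orbit S x"
  proof
    show "y = s (inv s y)" using bij[OF s] by (simp add: bij_is_surj surj_f_inv_f)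
    show "inv s y \<in> gen_orbit S x"
      using that by (rule gen_orbit_closed[OF gen_inv[OF gen_base[OF s]]])
  qed
qed

lemma irreducible_on_gen_orbit:
  assumes bij: "\<And>s. s \<in> S \<Longrightarrow> bij s"
  shows "irreducible_on S (gen_orbit S x)"
  unfolding irreducible_on_def
proof (intro allI impI)
  fix E assume subset: "E \<subseteq> gen_orbit S x" and invariant: "invariant_under S E"
  show "E = {} \<or> E = gen_orbit S x"
  proof (cases "E = {}")
    case False
    then obtain f where f: "f \<in> gen_group S" "f x \<in> E"
      using subset by (auto simp: gen_orbit_def)
    have "inv f (f x) \<in> E" using gen_group_image_eq[OF gen_inv[OF f(1)] bij invariant] f(2) by blast
    then have "x \<in> E" using gen_group_bij[OF f(1) bij] by (simp add: bij_is_inj)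
    then have "gen_orbit S x \<subseteq> E" using bij invariant by (intro gen_orbit_subset)
    then show ?thesis using subset by blast
  qed simp
qed

lemma gen_orbit_in_components:
  assumes perm: "\<And>s. s \<in> S \<Longrightarrow> s permutes A" and "x \<in> A"
  shows "gen_orbit S x \<in> components S A"
proof -
  note bij = permutes_bij[OF perm]
  have "gen_orbit S x \<subseteq> A"
    using bij invariant_under_permutes[OF perm] assms(2) by (rule gen_orbit_subset)
  moreover have "gen_orbit S x \<noteq> {}" using mem_gen_orbit_self by blast
  moreover have "invariant_under S (gen_orbit S x)" using bij by (rule invariant_under_gen_orbit)
  moreover have "irreducible_on S (gen_orbit S x)" using bij by (rule irreducible_on_gen_orbit)
  ultimately show ?thesis by (simp add: components_def)
qed

lemma gen_group_transitive_iff_irreducible_on: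
  assumes perm: "\<And>s. s \<in> S \<Longrightarrow> s permutes A"
  shows "(\<forall>x\<in>A. \<forall>y\<in>A. \<exists>f\<in>gen_group S. f x = y) \<longleftrightarrow> irreducible_on S A"
proof
  note bij = permutes_bij[OF perm]
  show "irreducible_on S A" if trans: "\<forall>x\<in>A. \<forall>y\<in>A. \<exists>f\<in>gen_group S. f x = y"
    unfolding irreducible_on_def
  proof (intro allI impI)
    fix E assume subset: "E \<subseteq> A" and invariant: "invariant_under S E"
    have "y \<in> E" if "x \<in> E" "y \<in> A" for x y
    proof -
      have "x \<in> A" using subset \<open>x \<in> E\<close> by blast
      then obtain f where "f \<in> gen_group S" "f x = y" using trans \<open>y \<in> A\<close> by blast
      then show ?thesis using gen_group_image_eq[OF _ bij invariant, of f] \<open>x \<in> E\<close> by blast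
    qed
    then show "E = {} \<or> E = A" using subset by blast
  qed
  show "\<forall>x\<in>A. \<forall>y\<in>A. \<exists>f\<in>gen_group S. f x = y" if irreducible: "irreducible_on S A"
  proof (intro ballI)
    fix x y assume "x \<in> A" "y \<in> A"
    have "gen_orbit S x \<in> components S A" using perm \<open>x \<in> A\<close> by (rule gen_orbit_in_components)
    then have "gen_orbit S x = A" using irreducible by (auto simp: components_def irreducible_on_def)
    then show "\<exists>f\<in>gen_group S. f x = y"
      using \<open>y \<in> A\<close> by (auto simp: gen_orbit_def)
  qed
qed

lemma partition_on_components:
  fixes A :: "nat set"
  assumes perm: "\<And>s. s \<in> S \<Longrightarrow> s permutes A"
  shows "partition_on A (components S A)"
proof (rule partition_onI)
  note bij = permutes_bij[OF perm]
  show "\<Union>(components S A) = A"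
  proof
    show "A \<subseteq> \<Union>(components S A)"
      using gen_orbit_in_components[OF perm] mem_gen_orbit_self by blast
  qed (auto simp: components_def)
  fix B C assume BC: "B \<in> components S A" "C \<in> components S A" "B \<noteq> C"
  have "invariant_under S (B \<inter> C)"
    using BC by (intro invariant_under_Int) (auto simp: components_def bij bij_is_inj)
  moreover have "irreducible_on S B" "irreducible_on S C"
    using BC by (simp_all add: components_def)
  ultimately have "B \<inter> C = {} \<or> B \<inter> C = B" "B \<inter> C = {} \<or> B \<inter> C = C"
    unfolding irreducible_on_def by (meson inf_le1, meson inf_le2)
  then show "disjnt B C" using BC(3) by (auto simp: disjnt_def)
qed (simp add: components_def)

lemma irreducible_on_Un_eq:
  assumes "\<And>E. invariant_under S E \<Longrightarrow> invariant_under T E"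
  shows "irreducible_on (S \<union> T) B \<longleftrightarrow> irreducible_on S B"
proof -
  have "invariant_under (S \<union> T) E \<longleftrightarrow> invariant_under S E" for E
    using assms[of E] by (auto simp: invariant_under_def)
  then show ?thesis by (simp add: irreducible_on_def)
qed

section \<open>Permutations with disjoint supports\<close>

lemma comp_disjoint_apply:
  assumes "\<sigma> permutes B" "\<tau> permutes C" "B \<inter> C = {}"
  shows "x \<in> B \<Longrightarrow> (\<sigma> \<circ> \<tau>) x = \<sigma> x" and "x \<in> C \<Longrightarrow> (\<sigma> \<circ> \<tau>) x = \<tau> x"
proof -
  have "\<tau> x = x" if "x \<in> B" using that assms(2,3) by (auto simp: permutes_not_in disjoint_iff)
  then show "(\<sigma> \<circ> \<tau>) x = \<sigma> x" if "x \<in> B" using that by simp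
  have "\<tau> x \<notin> B" if "x \<in> C" using that assms(2,3) by (auto simp: permutes_in_image disjoint_iff)
  then show "(\<sigma> \<circ> \<tau>) x = \<tau> x" if "x \<in> C" using that assms(1) by (simp add: permutes_not_in)
qed

lemma permutes_disjoint_commute:
  assumes "\<sigma> permutes B" "\<tau> permutes C" "B \<inter> C = {}"
  shows "\<sigma> \<circ> \<tau> = \<tau> \<circ> \<sigma>"
proof
  fix x
  show "(\<sigma> \<circ> \<tau>) x = (\<tau> \<circ> \<sigma>) x"
    using comp_disjoint_apply[OF assms, of x] comp_disjoint_apply[OF assms(2,1), of x] assms
    by (cases "x \<in> B"; cases "x \<in> C") (auto simp: permutes_not_in Int_commute)
qed

lemma comp_disjoint_inject:
  assumes "\<sigma> permutes B" "\<sigma>' permutes B" "\<tau> permutes C" "\<tau>' permutes C" "B \<inter> C = {}"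
  shows "\<sigma> \<circ> \<tau> = \<sigma>' \<circ> \<tau>' \<longleftrightarrow> \<sigma> = \<sigma>' \<and> \<tau> = \<tau>'"
proof
  assume eq: "\<sigma> \<circ> \<tau> = \<sigma>' \<circ> \<tau>'"
  have "\<sigma> x = \<sigma>' x" for x
    using comp_disjoint_apply(1)[OF assms(1,3,5)] comp_disjoint_apply(1)[OF assms(2,4,5)] assms(1,2) eq
    by (cases "x \<in> B") (auto simp: permutes_not_in)
  moreover have "\<tau> x = \<tau>' x" for x
    using comp_disjoint_apply(2)[OF assms(1,3,5)] comp_disjoint_apply(2)[OF assms(2,4,5)] assms(3,4) eq
    by (cases "x \<in> C") (auto simp: permutes_not_in)
  ultimately show "\<sigma> = \<sigma>' \<and> \<tau> = \<tau>'" by blast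
qed simp

lemma image_comp_disjoint:
  assumes "\<sigma> permutes B" "\<tau> permutes C" "B \<inter> C = {}"
  shows "(\<sigma> \<circ> \<tau>) ` B = B"
  using comp_disjoint_apply(1)[OF assms] permutes_image[OF assms(1)] by (metis image_cong)

lemma permutes_Un_decompose:
  assumes perm: "\<pi> permutes B \<union> C" and disj: "B \<inter> C = {}" and image: "\<pi> ` B = B"
  obtains \<sigma> \<tau> where "\<sigma> permutes B" "\<tau> permutes C" "\<pi> = \<sigma> \<circ> \<tau>"
proof
  have inj: "inj \<pi>" using perm by (rule permutes_inj)
  have "\<pi> ` (B \<union> C - B) = B \<union> C - B"
    using image_set_diff[OF inj, of "B \<union> C" B] image permutes_image[OF perm] by simp
  moreover have "B \<union> C - B = C" using disj by blast
  ultimately have image_C: "\<pi> ` C = C" by simp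
  show "restrict_id \<pi> B permutes B" "restrict_id \<pi> C permutes C"
    using image image_C inj_on_subset[OF inj subset_UNIV]
    by (auto intro!: permutes_restrict_id simp: bij_betw_def)
  show "\<pi> = restrict_id \<pi> B \<circ> restrict_id \<pi> C"
    using perm disj image_C by (force simp: fun_eq_iff restrict_id_def permutes_not_in)
qed

lemma irreducible_on_comp_disjoint:
  assumes "\<sigma>1 permutes B" "\<rho>1 permutes B" "\<sigma>2 permutes C" "\<rho>2 permutes C" "B \<inter> C = {}"
  shows "irreducible_on {\<sigma>1 \<circ> \<sigma>2, \<rho>1 \<circ> \<rho>2} B \<longleftrightarrow> irreducible_on {\<sigma>1, \<rho>1} B"
proof -
  have "(\<sigma>1 \<circ> \<sigma>2) ` E = \<sigma>1 ` E" "(\<rho>1 \<circ> \<rho>2) ` E = \<rho>1 ` E" if "E \<subseteq> B" for E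
    using that assms by (auto intro!: image_cong simp: comp_disjoint_apply simp del: o_apply)
  then show ?thesis by (simp add: irreducible_on_def invariant_under_def)
qed

section \<open>Cycle types\<close>

definition cycle_type_on :: "'a set \<Rightarrow> ('a \<Rightarrow> 'a) \<Rightarrow> nat multiset" where
  "cycle_type_on A \<pi> = image_mset card (mset_set (orbit \<pi> ` A))"

lemma cycle_type_eq_cycle_type_on: "cycle_type n = cycle_type_on {1..n}"
  by (simp add: fun_eq_iff cycle_type_def cycle_type_on_def)

lemma size_cycle_type_on: "size (cycle_type_on A \<pi>) = card (orbit \<pi> ` A)"
  by (simp add: cycle_type_on_def)

lemma orbit_eq_iff_mem:
  assumes "permutation \<pi>"
  shows "orbit \<pi> x = orbit \<pi> y \<longleftrightarrow> x \<in> orbit \<pi> y"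
  using assms orbit_cyclic_eq3[OF cyclic_on_orbit'] permutation_self_in_orbit by metis

lemma partition_on_orbits:
  assumes "finite A" "\<pi> permutes A"
  shows "partition_on A (orbit \<pi> ` A)"
proof (rule partition_onI)
  have perm: "permutation \<pi>" using assms by (rule permutes_imp_permutation)
  show "\<Union>(orbit \<pi> ` A) = A"
    using permutes_orbit_subset[OF assms(2)] permutation_self_in_orbit[OF perm] by blast
  show "disjnt C D" if "C \<in> orbit \<pi> ` A" "D \<in> orbit \<pi> ` A" "C \<noteq> D" for C D
    using that orbit_eq_iff_mem[OF perm] unfolding disjnt_iff by blast
  show "{} \<notin> orbit \<pi> ` A" using orbit_nonempty[of \<pi>] by (metis imageE)
qed

lemma sum_mset_cycle_type_on:
  assumes "finite A" "\<pi> permutes A"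
  shows "sum_mset (cycle_type_on A \<pi>) = card A"
proof -
  have "finite C" if "C \<in> orbit \<pi> ` A" for C
    using that permutes_orbit_subset[OF assms(2)] assms(1) by (auto intro: finite_subset)
  then show ?thesis
    using product_partition[OF partition_on_orbits[OF assms]]
    by (simp add: cycle_type_on_def sum_unfold_sum_mset)
qed

lemma cycle_type_on_comp_disjoint:
  assumes "finite B" "finite C" and disj: "B \<inter> C = {}" and \<sigma>: "\<sigma> permutes B" and \<tau>: "\<tau> permutes C"
  shows "cycle_type_on (B \<union> C) (\<sigma> \<circ> \<tau>) = cycle_type_on B \<sigma> + cycle_type_on C \<tau>"
proof -
  note apply_eq = comp_disjoint_apply[OF \<sigma> \<tau> disj]
  have "orbit (\<sigma> \<circ> \<tau>) x = orbit \<sigma> x" if "x \<in> B" for x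
    using that by (intro orbit_cong0[symmetric])
      (auto simp: apply_eq permutes_in_image[OF \<sigma>] simp del: o_apply)
  moreover have "orbit (\<sigma> \<circ> \<tau>) x = orbit \<tau> x" if "x \<in> C" for x
    using that by (intro orbit_cong0[symmetric])
      (auto simp: apply_eq permutes_in_image[OF \<tau>] simp del: o_apply)
  ultimately have image: "orbit (\<sigma> \<circ> \<tau>) ` (B \<union> C) = orbit \<sigma> ` B \<union> orbit \<tau> ` C"
    by (auto simp: image_Un)
  have "orbit \<sigma> ` B \<inter> orbit \<tau> ` C = {}"
  proof (rule equals0I)
    fix D assume "D \<in> orbit \<sigma> ` B \<inter> orbit \<tau> ` C"
    then have "D \<subseteq> B" "D \<subseteq> C" "D \<noteq> {}"
      using permutes_orbit_subset[OF \<sigma>] permutes_orbit_subset[OF \<tau>] orbit_nonempty by (fastforce+)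
    then show False using disj by blast
  qed
  then show ?thesis
    using assms(1,2) by (simp add: cycle_type_on_def image mset_set_Union)
qed

lemma cycle_type_on_map_permutation:
  assumes f: "bij_betw f A B" and "finite A" and \<pi>: "\<pi> permutes A"
  shows "cycle_type_on B (map_permutation A f \<pi>) = cycle_type_on A \<pi>"
proof -
  have inj: "inj_on f A" and B: "B = f ` A" using f by (auto simp: bij_betw_def)
  have subset: "orbit \<pi> x \<subseteq> A" if "x \<in> A" for x using permutes_orbit_subset[OF \<pi> that] .
  have "orbit (map_permutation A f \<pi>) (f x) = f ` orbit \<pi> x" if "x \<in> A" for x
  proof (rule orbit_inverse[symmetric])
    show "x \<in> orbit \<pi> x"
      by (rule permutation_self_in_orbit) (rule permutes_imp_permutation[OF \<open>finite A\<close> \<pi>])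
    show "map_permutation A f \<pi> (f y) = f (\<pi> y)" if "y \<in> orbit \<pi> x" for y
      using that subset[OF \<open>x \<in> A\<close>] by (intro map_permutation_apply[OF inj]) blast
  qed
  then have "orbit (map_permutation A f \<pi>) ` B = image f ` orbit \<pi> ` A"
    by (simp add: B image_image cong: image_cong)
  moreover have "inj_on (image f) (orbit \<pi> ` A)"
    using subset by (intro inj_on_subset[OF inj_on_image_Pow[OF inj]]) auto
  ultimately have "cycle_type_on B (map_permutation A f \<pi>) =
      image_mset (\<lambda>C. card (f ` C)) (mset_set (orbit \<pi> ` A))"
    by (simp add: cycle_type_on_def multiset.map_comp comp_def flip: image_mset_mset_set)
  also have "\<dots> = cycle_type_on A \<pi>"
    unfolding cycle_type_on_def using subset \<open>finite A\<close>
    by (intro image_mset_cong card_image inj_on_subset[OF inj]) auto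
  finally show ?thesis .
qed

section \<open>Commutators\<close>

lemma commutator_permutes: "\<sigma> permutes A \<Longrightarrow> \<rho> permutes A \<Longrightarrow> commutator \<sigma> \<rho> permutes A"
  unfolding commutator_def by (intro permutes_compose permutes_inv)

lemma commutator_in_gen_group: "commutator \<sigma> \<rho> \<in> gen_group {\<sigma>, \<rho>}"
  unfolding commutator_def by (intro gen_comp gen_inv gen_base) auto

lemma commutator_comp_disjoint:
  assumes "\<sigma>1 permutes B" "\<rho>1 permutes B" "\<sigma>2 permutes C" "\<rho>2 permutes C" "B \<inter> C = {}"
  shows "commutator (\<sigma>1 \<circ> \<sigma>2) (\<rho>1 \<circ> \<rho>2) = commutator \<sigma>1 \<rho>1 \<circ> commutator \<sigma>2 \<rho>2"
proof -
  have swap: "\<tau> (\<pi> x) = \<pi> (\<tau> x)" if "\<pi> permutes B" "\<tau> permutes C" for \<pi> \<tau> x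
    using permutes_disjoint_commute[OF that assms(5)] by (simp add: fun_eq_iff)
  note inverse = assms(1-4)[THEN permutes_inv]
  have "commutator (\<sigma>1 \<circ> \<sigma>2) (\<rho>1 \<circ> \<rho>2) =
      \<sigma>1 \<circ> \<sigma>2 \<circ> (\<rho>1 \<circ> \<rho>2) \<circ> (inv \<sigma>2 \<circ> inv \<sigma>1) \<circ> (inv \<rho>2 \<circ> inv \<rho>1)"
    using assms by (simp add: commutator_def o_inv_distrib permutes_bij)
  also have "\<dots> = commutator \<sigma>1 \<rho>1 \<circ> commutator \<sigma>2 \<rho>2"
    by (simp add: commutator_def fun_eq_iff swap[OF assms(2,3)]
        swap[OF inverse(1) assms(3)] swap[OF inverse(2) assms(3)]
        swap[OF inverse(1) assms(4)] swap[OF inverse(2) assms(4)]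
        swap[OF inverse(1,3)] swap[OF inverse(2,3)] swap[OF inverse(2,4)])
  finally show ?thesis .
qed

lemma inv_map_permutation:
  assumes "bij_betw f A B" "\<pi> permutes A"
  shows "inv (map_permutation A f \<pi>) = map_permutation A f (inv \<pi>)"
proof -
  have "inj_on f A" using assms(1) by (simp add: bij_betw_def)
  then show ?thesis
    using permutes_inv[OF assms(2)] assms(2)
    by (intro inv_unique_comp)
      (simp_all flip: map_permutation_compose' add: permutes_inv_o map_permutation_id')
qed

lemma commutator_map_permutation:
  assumes f: "bij_betw f A B" and "\<sigma> permutes A" "\<rho> permutes A"
  shows "commutator (map_permutation A f \<sigma>) (map_permutation A f \<rho>) =
    map_permutation A f (commutator \<sigma> \<rho>)"
proof -
  have "inj_on f A" using f by (simp add: bij_betw_def)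
  then show ?thesis
    using assms by (simp add: commutator_def inv_map_permutation map_permutation_compose' permutes_inv)
qed

section \<open>Origamis and the exponential formula\<close>

definition origamis :: "nat set \<Rightarrow> nat multiset \<Rightarrow> ((nat \<Rightarrow> nat) \<times> (nat \<Rightarrow> nat)) set" where
  "origamis A lam =
    {(\<sigma>, \<rho>). \<sigma> permutes A \<and> \<rho> permutes A \<and> cycle_type_on A (commutator \<sigma> \<rho>) = lam}"

definition connected_origamis :: "nat set \<Rightarrow> nat multiset \<Rightarrow> ((nat \<Rightarrow> nat) \<times> (nat \<Rightarrow> nat)) set" where
  "connected_origamis A lam = {(\<sigma>, \<rho>) \<in> origamis A lam. irreducible_on {\<sigma>, \<rho>} A}"

lemma finite_origamis: "finite A \<Longrightarrow> finite (origamis A lam)"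
  by (rule finite_subset[of _ "{\<sigma>. \<sigma> permutes A} \<times> {\<rho>. \<rho> permutes A}"])
    (auto simp: origamis_def finite_permutations)

lemma connected_origamis_subset: "connected_origamis A lam \<subseteq> origamis A lam"
  by (auto simp: connected_origamis_def)

lemma finite_connected_origamis: "finite A \<Longrightarrow> finite (connected_origamis A lam)"
  by (rule finite_subset[OF connected_origamis_subset finite_origamis])

lemma origamis_eq_empty:
  assumes "finite A" "card A \<noteq> sum_mset lam"
  shows "origamis A lam = {}"
  using assms sum_mset_cycle_type_on[OF assms(1) commutator_permutes] by (auto simp: origamis_def)

lemma irreducible_on_map_permutation:
  assumes f: "bij_betw f A B" and perm: "\<And>s. s \<in> S \<Longrightarrow> s permutes A"
    and irreducible: "irreducible_on S A"
  shows "irreducible_on (map_permutation A f ` S) B"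
  unfolding irreducible_on_def
proof (intro allI impI)
  have inj: "inj_on f A" and B: "B = f ` A" using f by (auto simp: bij_betw_def)
  fix E assume "E \<subseteq> B" and invariant: "invariant_under (map_permutation A f ` S) E"
  then obtain D where D: "D \<subseteq> A" "E = f ` D" by (auto simp: B subset_image_iff)
  have "s ` D = D" if s: "s \<in> S" for s
  proof -
    have "f ` s ` D = map_permutation A f s ` E"
      using D(1) by (force simp: D(2) image_image map_permutation_apply[OF inj] intro!: image_cong)
    also have "\<dots> = f ` D" using invariant s D(2) by (simp add: invariant_under_def)
    finally show ?thesis
      using inj D(1) permutes_image[OF perm[OF s]] by (subst (asm) inj_on_image_eq_iff) auto
  qed
  then have "D = {} \<or> D = A"
    using irreducible D(1) by (simp add: irreducible_on_def invariant_under_def)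
  then show "E = {} \<or> E = B" by (auto simp: D(2) B)
qed

lemma map_permutation_origamis:
  assumes f: "bij_betw f A B" and "finite A"
  shows "map_prod (map_permutation A f) (map_permutation A f) ` origamis A lam \<subseteq> origamis B lam"
    and "map_prod (map_permutation A f) (map_permutation A f) ` connected_origamis A lam \<subseteq>
      connected_origamis B lam"
proof -
  let ?F = "map_prod (map_permutation A f) (map_permutation A f)"
  show origamis: "?F ` origamis A lam \<subseteq> origamis B lam"
    using assms
    by (auto simp: origamis_def map_permutation_permutes commutator_map_permutation
        cycle_type_on_map_permutation commutator_permutes)
  show "?F ` connected_origamis A lam \<subseteq> connected_origamis B lam"
  proof clarsimp
    fix \<sigma> \<rho> assume conn: "(\<sigma>, \<rho>) \<in> connected_origamis A lam"
    then have "irreducible_on (map_permutation A f ` {\<sigma>, \<rho>}) B"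
      by (intro irreducible_on_map_permutation[OF f]) (auto simp: connected_origamis_def origamis_def)
    moreover have "(map_permutation A f \<sigma>, map_permutation A f \<rho>) \<in> origamis B lam"
      using conn origamis connected_origamis_subset by fastforce
    ultimately show "(map_permutation A f \<sigma>, map_permutation A f \<rho>) \<in> connected_origamis B lam"
      by (simp add: connected_origamis_def)
  qed
qed

lemma inj_on_map_permutation:
  assumes f: "bij_betw f A B"
  shows "inj_on (map_permutation A f) {\<pi>. \<pi> permutes A}"
  by (rule inj_on_inverseI[where g = "map_permutation B (inv_into A f)"])
    (simp add: map_permutation_compose_inv[OF f] bij_betw_inv_into_left[OF f])

lemma card_origamis_le:
  assumes "finite A" "finite B" "card A = card B"
  shows "card (origamis A lam) \<le> card (origamis B lam)"
    and "card (connected_origamis A lam) \<le> card (connected_origamis B lam)"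
proof -
  obtain f where f: "bij_betw f A B" using assms finite_same_card_bij by blast
  let ?F = "map_prod (map_permutation A f) (map_permutation A f)"
  have inj: "inj_on ?F (origamis A lam)"
    using map_prod_inj_on[OF inj_on_map_permutation[OF f] inj_on_map_permutation[OF f]]
    by (rule inj_on_subset) (auto simp: origamis_def)
  show "card (origamis A lam) \<le> card (origamis B lam)"
    using inj map_permutation_origamis(1)[OF f assms(1)] finite_origamis[OF assms(2)]
    by (rule card_inj_on_le)
  show "card (connected_origamis A lam) \<le> card (connected_origamis B lam)"
    using inj_on_subset[OF inj connected_origamis_subset] map_permutation_origamis(2)[OF f assms(1)]
      finite_connected_origamis[OF assms(2)]
    by (rule card_inj_on_le)
qed

lemma card_origamis_cong:
  assumes "finite A" "finite B" "card A = card B"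
  shows "card (origamis A lam) = card (origamis B lam)"
    and "card (connected_origamis A lam) = card (connected_origamis B lam)"
  using assms by (auto intro!: antisym card_origamis_le)

definition connected_weight :: "nat multiset \<Rightarrow> real" where
  "connected_weight lam = card (connected_origamis {1..sum_mset lam} lam) / fact (sum_mset lam)"

lemma card_origamis:
  assumes "finite A"
  shows "card (origamis A lam) = (if card A = sum_mset lam then fact (card A) * hcirc lam else 0)"
proof -
  have "hcirc lam = card (origamis {1..sum_mset lam} lam) / fact (sum_mset lam)"
    by (simp add: hcirc_def origamis_def cycle_type_eq_cycle_type_on Let_def)
  then show ?thesis
    using assms card_origamis_cong(1)[OF assms, of "{1..sum_mset lam}" lam]
    by (auto simp: origamis_eq_empty)
qed

lemma card_connected_origamis:
  assumes "finite A"
  shows "card (connected_origamis A lam) =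
    (if card A = sum_mset lam then fact (card A) * connected_weight lam else 0)"
proof (cases "card A = sum_mset lam")
  case True
  then show ?thesis
    using card_origamis_cong(2)[OF assms, of "{1..sum_mset lam}" lam]
    by (simp add: connected_weight_def)
next
  case False
  then have "connected_origamis A lam = {}"
    using connected_origamis_subset[of A lam] origamis_eq_empty[OF assms False] by simp
  then show ?thesis using False by simp
qed

lemma comp_disjoint_in_origamis_iff:
  assumes "finite B" "finite C" "B \<inter> C = {}"
    and "\<sigma>1 permutes B" "\<rho>1 permutes B" "\<sigma>2 permutes C" "\<rho>2 permutes C"
  shows "(\<sigma>1 \<circ> \<sigma>2, \<rho>1 \<circ> \<rho>2) \<in> origamis (B \<union> C) lam \<longleftrightarrow>
    cycle_type_on B (commutator \<sigma>1 \<rho>1) + cycle_type_on C (commutator \<sigma>2 \<rho>2) = lam"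
proof -
  have "\<sigma>1 \<circ> \<sigma>2 permutes B \<union> C" "\<rho>1 \<circ> \<rho>2 permutes B \<union> C"
    using assms(4-7) by (auto intro!: permutes_compose intro: permutes_subset)
  moreover have "cycle_type_on (B \<union> C) (commutator (\<sigma>1 \<circ> \<sigma>2) (\<rho>1 \<circ> \<rho>2)) =
      cycle_type_on B (commutator \<sigma>1 \<rho>1) + cycle_type_on C (commutator \<sigma>2 \<rho>2)"
    unfolding commutator_comp_disjoint[OF assms(4-7,3)]
    by (intro cycle_type_on_comp_disjoint commutator_permutes assms)
  ultimately show ?thesis by (simp add: origamis_def)
qed

lemma component_comp_disjoint_iff:
  assumes "B \<inter> C = {}" "\<sigma>1 permutes B" "\<rho>1 permutes B" "\<sigma>2 permutes C" "\<rho>2 permutes C"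
  shows "B \<in> components {\<sigma>1 \<circ> \<sigma>2, \<rho>1 \<circ> \<rho>2} (B \<union> C) \<longleftrightarrow> B \<noteq> {} \<and> irreducible_on {\<sigma>1, \<rho>1} B"
  using image_comp_disjoint[OF assms(2,4,1)] image_comp_disjoint[OF assms(3,5,1)]
    irreducible_on_comp_disjoint[OF assms(2-5,1)]
  by (auto simp: components_def invariant_under_def)

lemma origami_component_decompose:
  assumes fin: "finite B" "finite C" and disj: "B \<inter> C = {}"
    and origami: "(\<sigma>, \<rho>) \<in> origamis (B \<union> C) lam" and component: "B \<in> components {\<sigma>, \<rho>} (B \<union> C)"
  obtains \<mu> \<sigma>1 \<rho>1 \<sigma>2 \<rho>2 where "\<mu> \<subseteq># lam" "(\<sigma>1, \<rho>1) \<in> connected_origamis B \<mu>"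
    "(\<sigma>2, \<rho>2) \<in> origamis C (lam - \<mu>)" "\<sigma> = \<sigma>1 \<circ> \<sigma>2" "\<rho> = \<rho>1 \<circ> \<rho>2"
proof -
  have perm: "\<sigma> permutes B \<union> C" "\<rho> permutes B \<union> C" and image: "\<sigma> ` B = B" "\<rho> ` B = B"
    using origami component by (auto simp: origamis_def components_def invariant_under_def)
  obtain \<sigma>1 \<sigma>2 where \<sigma>: "\<sigma>1 permutes B" "\<sigma>2 permutes C" "\<sigma> = \<sigma>1 \<circ> \<sigma>2"
    using perm(1) disj image(1) by (rule permutes_Un_decompose)
  obtain \<rho>1 \<rho>2 where \<rho>: "\<rho>1 permutes B" "\<rho>2 permutes C" "\<rho> = \<rho>1 \<circ> \<rho>2"
    using perm(2) disj image(2) by (rule permutes_Un_decompose)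
  let ?\<mu> = "cycle_type_on B (commutator \<sigma>1 \<rho>1)"
  have lam: "?\<mu> + cycle_type_on C (commutator \<sigma>2 \<rho>2) = lam"
    using origami comp_disjoint_in_origamis_iff[OF fin disj \<sigma>(1) \<rho>(1) \<sigma>(2) \<rho>(2)] \<sigma>(3) \<rho>(3) by simp
  have "irreducible_on {\<sigma>1, \<rho>1} B"
    using component component_comp_disjoint_iff[OF disj \<sigma>(1) \<rho>(1) \<sigma>(2) \<rho>(2)] \<sigma>(3) \<rho>(3) by simp
  then have "(\<sigma>1, \<rho>1) \<in> connected_origamis B ?\<mu>"
    using \<sigma>(1) \<rho>(1) by (simp add: connected_origamis_def origamis_def)
  moreover have "(\<sigma>2, \<rho>2) \<in> origamis C (lam - ?\<mu>)" "?\<mu> \<subseteq># lam"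
    using \<sigma>(2) \<rho>(2) lam by (auto simp: origamis_def)
  ultimately show thesis using \<sigma>(3) \<rho>(3) that by blast
qed

lemma bij_betw_origamis_component:
  assumes fin: "finite B" "finite C" and disj: "B \<inter> C = {}" and "B \<noteq> {}"
  shows "bij_betw (\<lambda>(\<mu>, (\<sigma>1, \<rho>1), (\<sigma>2, \<rho>2)). (\<sigma>1 \<circ> \<sigma>2, \<rho>1 \<circ> \<rho>2))
    (SIGMA \<mu>:{\<mu>. \<mu> \<subseteq># lam}. connected_origamis B \<mu> \<times> origamis C (lam - \<mu>))
    {(\<sigma>, \<rho>) \<in> origamis (B \<union> C) lam. B \<in> components {\<sigma>, \<rho>} (B \<union> C)}"
    (is "bij_betw ?glue ?S ?R")
  unfolding bij_betw_def
proof
  show "inj_on ?glue ?S"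
    by (rule inj_onI)
      (auto simp: connected_origamis_def origamis_def comp_disjoint_inject[OF _ _ _ _ disj]
        simp del: o_apply)
  show "?glue ` ?S = ?R"
  proof (intro equalityI subsetI)
    fix r assume "r \<in> ?glue ` ?S"
    then obtain \<mu> \<sigma>1 \<rho>1 \<sigma>2 \<rho>2 where r: "r = (\<sigma>1 \<circ> \<sigma>2, \<rho>1 \<circ> \<rho>2)" and "\<mu> \<subseteq># lam"
      and "(\<sigma>1, \<rho>1) \<in> connected_origamis B \<mu>" "(\<sigma>2, \<rho>2) \<in> origamis C (lam - \<mu>)"
      by auto
    then have perm: "\<sigma>1 permutes B" "\<rho>1 permutes B" "\<sigma>2 permutes C" "\<rho>2 permutes C"
      and irreducible: "irreducible_on {\<sigma>1, \<rho>1} B"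
      and lam: "cycle_type_on B (commutator \<sigma>1 \<rho>1) + cycle_type_on C (commutator \<sigma>2 \<rho>2) = lam"
      by (auto simp: connected_origamis_def origamis_def)
    show "r \<in> ?R"
      using lam irreducible \<open>B \<noteq> {}\<close>
      by (simp add: r comp_disjoint_in_origamis_iff[OF fin disj perm]
          component_comp_disjoint_iff[OF disj perm])
  next
    fix r assume "r \<in> ?R"
    then show "r \<in> ?glue ` ?S"
      by (force elim: origami_component_decompose[OF fin disj])
  qed
qed

lemma card_origamis_component:
  assumes "finite A" "B \<subseteq> A" "B \<noteq> {}"
  shows "card {(\<sigma>, \<rho>) \<in> origamis A lam. B \<in> components {\<sigma>, \<rho>} A} =
    (\<Sum>\<mu> | \<mu> \<subseteq># lam. card (connected_origamis B \<mu>) * card (origamis (A - B) (lam - \<mu>)))"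
proof -
  have fin: "finite B" "finite (A - B)" using assms by (auto intro: finite_subset)
  have "B \<union> (A - B) = A" using assms(2) by blast
  then have "card {(\<sigma>, \<rho>) \<in> origamis A lam. B \<in> components {\<sigma>, \<rho>} A} =
      card (SIGMA \<mu>:{\<mu>. \<mu> \<subseteq># lam}. connected_origamis B \<mu> \<times> origamis (A - B) (lam - \<mu>))"
    using bij_betw_same_card[OF bij_betw_origamis_component[OF fin _ assms(3), of lam]] by simp
  also have "\<dots> = (\<Sum>\<mu> | \<mu> \<subseteq># lam. card (connected_origamis B \<mu> \<times> origamis (A - B) (lam - \<mu>)))"
    by (rule card_SigmaI)
      (auto simp: finite_subseteq_mset finite_connected_origamis finite_origamis fin)
  finally show ?thesis by (simp add: card_cartesian_product)
qed

text \<open>Count the origamis together with a marked point, sorted by the component of the marked point.\<close>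
lemma card_origamis_recursion:
  assumes fin: "finite A"
  shows "card A * card (origamis A lam) = (\<Sum>B\<in>Pow A. card B *
    (\<Sum>\<mu> | \<mu> \<subseteq># lam. card (connected_origamis B \<mu>) * card (origamis (A - B) (lam - \<mu>))))"
proof -
  let ?R = "\<lambda>r B. B \<in> components {fst r, snd r} A"
  have "card A = (\<Sum>B | B \<in> Pow A \<and> ?R r B. card B)" if "r \<in> origamis A lam" for r
  proof -
    have "partition_on A (components {fst r, snd r} A)"
      using that by (intro partition_on_components) (auto simp: origamis_def)
    then have "card A = (\<Sum>B\<in>components {fst r, snd r} A. card B)"
      by (rule product_partition) (auto simp: components_def intro: finite_subset[OF _ fin])
    also have "components {fst r, snd r} A = {B \<in> Pow A. ?R r B}"
      by (auto simp: components_def)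
    finally show ?thesis by simp
  qed
  then have "(\<Sum>r\<in>origamis A lam. card A) =
      (\<Sum>r\<in>origamis A lam. \<Sum>B | B \<in> Pow A \<and> ?R r B. card B)"
    by (rule sum.cong[OF refl])
  also have "\<dots> = (\<Sum>B\<in>Pow A. \<Sum>r | r \<in> origamis A lam \<and> ?R r B. card B)"
    using fin by (intro sum.swap_restrict) (auto simp: finite_origamis)
  also have "\<dots> = (\<Sum>B\<in>Pow A. card B *
      (\<Sum>\<mu> | \<mu> \<subseteq># lam. card (connected_origamis B \<mu>) * card (origamis (A - B) (lam - \<mu>))))"
  proof (rule sum.cong)
    fix B assume "B \<in> Pow A"
    moreover have "{r \<in> origamis A lam. ?R r B} = {(\<sigma>, \<rho>) \<in> origamis A lam. B \<in> components {\<sigma>, \<rho>} A}"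
      by auto
    ultimately show "(\<Sum>r | r \<in> origamis A lam \<and> ?R r B. card B) = card B *
        (\<Sum>\<mu> | \<mu> \<subseteq># lam. card (connected_origamis B \<mu>) * card (origamis (A - B) (lam - \<mu>)))"
      using card_origamis_component[OF fin, of B lam] by (cases "B = {}") simp_all
  qed simp
  finally show ?thesis by (simp add: mult.commute)
qed

lemma sum_Pow_connected_times_complement:
  assumes "finite A" "sum_mset \<mu> + sum_mset \<nu> = card A"
  shows "(\<Sum>B\<in>Pow A. real (card B * card (connected_origamis B \<mu>) * card (origamis (A - B) \<nu>))) =
    fact (card A) * (sum_mset \<mu> * connected_weight \<mu> * hcirc \<nu>)"
proof -
  let ?k = "sum_mset \<mu>"
  let ?t = "\<lambda>B. real (card B * card (connected_origamis B \<mu>) * card (origamis (A - B) \<nu>))"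
  let ?c = "?k * (fact ?k * connected_weight \<mu>) * (fact (card A - ?k) * hcirc \<nu>)"
  have fin: "finite B" if "B \<subseteq> A" for B using that assms(1) by (rule finite_subset)
  have "sum ?t (Pow A) = sum ?t {B. B \<subseteq> A \<and> card B = ?k}"
    using assms(1) fin by (intro sum.mono_neutral_right) (auto simp: card_connected_origamis)
  also have "\<dots> = (\<Sum>B | B \<subseteq> A \<and> card B = ?k. ?c)"
    using assms fin
    by (intro sum.cong) (auto simp: card_connected_origamis card_origamis card_Diff_subset)
  also have "\<dots> = real (card A choose ?k) * ?c"
    using assms(1) by (simp add: n_subsets)
  also have "\<dots> = fact (card A) * (?k * connected_weight \<mu> * hcirc \<nu>)"
    using assms(2) by (simp add: binomial_fact)
  finally show ?thesis .
qed

lemma hcirc_recursion: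
  "real (sum_mset lam) * hcirc lam =
    (\<Sum>\<mu> | \<mu> \<subseteq># lam. real (sum_mset \<mu>) * connected_weight \<mu> * hcirc (lam - \<mu>))"
proof -
  let ?n = "sum_mset lam"
  let ?A = "{1..?n}"
  have "fact ?n * (real ?n * hcirc lam) = real (card ?A * card (origamis ?A lam))"
    by (simp add: card_origamis)
  also have "\<dots> = (\<Sum>B\<in>Pow ?A. \<Sum>\<mu> | \<mu> \<subseteq># lam.
      real (card B * card (connected_origamis B \<mu>) * card (origamis (?A - B) (lam - \<mu>))))"
    by (subst card_origamis_recursion) (simp_all add: sum_distrib_left mult.assoc)
  also have "\<dots> = (\<Sum>\<mu> | \<mu> \<subseteq># lam. \<Sum>B\<in>Pow ?A.
      real (card B * card (connected_origamis B \<mu>) * card (origamis (?A - B) (lam - \<mu>))))"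
    by (rule sum.swap)
  also have "\<dots> = (\<Sum>\<mu> | \<mu> \<subseteq># lam.
      fact ?n * (real (sum_mset \<mu>) * connected_weight \<mu> * hcirc (lam - \<mu>)))"
  proof (rule sum.cong)
    fix \<mu> assume "\<mu> \<in> {\<mu>. \<mu> \<subseteq># lam}"
    then have "sum_mset \<mu> + sum_mset (lam - \<mu>) = card ?A"
      by (simp flip: sum_mset.union)
    then show "(\<Sum>B\<in>Pow ?A.
          real (card B * card (connected_origamis B \<mu>) * card (origamis (?A - B) (lam - \<mu>)))) =
        fact ?n * (real (sum_mset \<mu>) * connected_weight \<mu> * hcirc (lam - \<mu>))"
      using sum_Pow_connected_times_complement[of ?A \<mu> "lam - \<mu>"] by simp
  qed simp
  finally show ?thesis by (simp flip: sum_distrib_left)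
qed

lemma hcoef_eq_connected_weight:
  assumes "sum_mset lam \<noteq> 0"
  shows "hcoef lam = connected_weight lam"
proof -
  have "origamis {} {#} = {(id, id)}"
    by (auto simp: origamis_def cycle_type_on_def)
  then have "hcirc {#} = 1"
    using card_origamis[of "{}" "{#}"] by simp
  then have "real (sum_mset lam) * log_coeff hcirc lam = real (sum_mset lam) * connected_weight lam"
    by (intro log_coeff_unique hcirc_recursion) simp_all
  moreover have "real (sum_mset lam) \<noteq> 0"
    using assms by (simp only: of_nat_eq_0_iff not_False_eq_True)
  ultimately show ?thesis by (simp only: mult_cancel_left hcoef_eq_log_coeff simp_thms)
qed

section \<open>Strictly monotone factorisations\<close>

definition monotone_factorisation :: "nat \<Rightarrow> (nat \<Rightarrow> nat) \<Rightarrow> (nat \<times> nat) list \<Rightarrow> bool" where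
  "monotone_factorisation n \<pi> ts \<longleftrightarrow> (\<forall>(a, b)\<in>set ts. 1 \<le> a \<and> a < b \<and> b \<le> n)
    \<and> strictly_monotone ts \<and> apply_transps ts = \<pi>"

lemma strictly_monotone_iff_sorted_wrt: "strictly_monotone ts \<longleftrightarrow> sorted_wrt (<) (map snd ts)"
  by (auto simp: strictly_monotone_def sorted_wrt_iff_nth_Suc_transp)

lemma monotone_factorisation_permutes:
  "monotone_factorisation n \<pi> ts \<Longrightarrow> \<pi> permutes {1..n}"
  using permutes_apply_transps[of ts "{1..n}"] by (fastforce simp: monotone_factorisation_def)

text \<open>Only the last factor of a strictly monotone factorisation can move the largest point.\<close>
lemma monotone_factorisation_Suc_iff:
  "monotone_factorisation (Suc n) \<pi> ts \<longleftrightarrow> monotone_factorisation n \<pi> ts \<or>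
    (\<exists>us a. ts = us @ [(a, Suc n)] \<and> a \<in> {1..n} \<and>
      monotone_factorisation n (\<pi> \<circ> transpose a (Suc n)) us)"
proof (cases ts rule: rev_cases)
  case Nil
  then show ?thesis by (auto simp: monotone_factorisation_def)
next
  case (snoc us t)
  obtain a b where t: "t = (a, b)" by (cases t)
  have "apply_transps ts = \<pi> \<longleftrightarrow> apply_transps us = \<pi> \<circ> transpose a b"
    by (auto simp: snoc t simp flip: o_assoc)
  moreover have "(\<forall>(c, d)\<in>set ts. 1 \<le> c \<and> c < d \<and> d \<le> m) \<and> strictly_monotone ts \<longleftrightarrow>
      1 \<le> a \<and> a < b \<and> b \<le> m \<and> (\<forall>(c, d)\<in>set us. 1 \<le> c \<and> c < d \<and> d \<le> b - 1)
      \<and> strictly_monotone us" for m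
    unfolding strictly_monotone_iff_sorted_wrt by (fastforce simp: sorted_wrt_append snoc t)
  ultimately have split_last: "monotone_factorisation m \<pi> ts \<longleftrightarrow> 1 \<le> a \<and> a < b \<and> b \<le> m
      \<and> monotone_factorisation (b - 1) (\<pi> \<circ> transpose a b) us" for m
    by (simp only: monotone_factorisation_def conj_assoc[symmetric])
  have "(\<exists>vs c. ts = vs @ [(c, Suc n)] \<and> c \<in> {1..n} \<and>
        monotone_factorisation n (\<pi> \<circ> transpose c (Suc n)) vs)
      \<longleftrightarrow> b = Suc n \<and> a \<in> {1..n} \<and> monotone_factorisation n (\<pi> \<circ> transpose a (Suc n)) us"
    by (auto simp: snoc t)
  then show ?thesis
    unfolding split_last by (cases "b = Suc n") auto
qed

lemma comp_transpose_not_permutes: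
  assumes "\<pi> permutes A" "a \<in> A" "N \<notin> A"
  shows "\<not> \<pi> \<circ> transpose a N permutes A"
proof
  assume "\<pi> \<circ> transpose a N permutes A"
  then have "\<pi> a = N" using permutes_not_in[of _ A N] assms(3) by fastforce
  then show False using assms permutes_in_image[OF assms(1), of a] by simp
qed

lemma monotone_factorisation_Suc_fixed:
  assumes "\<pi> permutes {1..n}"
  shows "monotone_factorisation (Suc n) \<pi> ts \<longleftrightarrow> monotone_factorisation n \<pi> ts"
  using comp_transpose_not_permutes[OF assms, of _ "Suc n"] monotone_factorisation_permutes
  by (auto simp: monotone_factorisation_Suc_iff)

lemma monotone_factorisation_Suc_moved:
  assumes \<pi>: "\<pi> permutes {1..n}" and a: "a \<in> {1..n}"
  shows "monotone_factorisation (Suc n) (\<pi> \<circ> transpose a (Suc n)) ts \<longleftrightarrow>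
    (\<exists>us. ts = us @ [(a, Suc n)] \<and> monotone_factorisation n \<pi> us)"
proof -
  let ?\<pi>' = "\<pi> \<circ> transpose a (Suc n)"
  have "\<not> ?\<pi>' permutes {1..n}"
    using comp_transpose_not_permutes[OF \<pi> a] by simp
  moreover have "c = a" if c: "c \<in> {1..n}" and perm: "?\<pi>' \<circ> transpose c (Suc n) permutes {1..n}" for c
  proof (rule ccontr)
    assume "c \<noteq> a"
    then have "\<pi> c = Suc n"
      using permutes_not_in[OF perm, of "Suc n"] c by (auto simp: transpose_def)
    then show False using permutes_in_image[OF \<pi>, of c] c by simp
  qed
  moreover have "?\<pi>' \<circ> transpose a (Suc n) = \<pi>" by (simp flip: o_assoc)
  ultimately show ?thesis
    using a monotone_factorisation_permutes unfolding monotone_factorisation_Suc_iff by metis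
qed

lemma permutes_insert_decompose:
  assumes "\<pi> permutes insert N A"
  obtains a \<rho> where "a \<in> insert N A" "\<rho> permutes A" "\<pi> = \<rho> \<circ> transpose a N"
proof
  let ?a = "inv \<pi> N"
  show a: "?a \<in> insert N A" using permutes_in_image[OF permutes_inv[OF assms]] by simp
  show "\<pi> \<circ> transpose ?a N permutes A"
  proof (rule permutes_superset)
    show "\<pi> \<circ> transpose ?a N permutes insert N A"
      using a by (intro permutes_compose permutes_swap_id assms) auto
  qed (auto simp: permutes_inverses[OF assms])
  show "\<pi> = \<pi> \<circ> transpose ?a N \<circ> transpose ?a N" by (simp flip: o_assoc)
qed

lemma permutes_atLeastAtMost_induct [consumes 1, case_names zero fixed moved]:
  assumes "\<pi> permutes {1..n}" and zero: "P 0 id"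
    and fixed: "\<And>n \<pi>. \<pi> permutes {1..n} \<Longrightarrow> P n \<pi> \<Longrightarrow> P (Suc n) \<pi>"
    and moved: "\<And>n \<pi> a. \<pi> permutes {1..n} \<Longrightarrow> a \<in> {1..n} \<Longrightarrow> P n \<pi> \<Longrightarrow>
      P (Suc n) (\<pi> \<circ> transpose a (Suc n))"
  shows "P n \<pi>"
  using assms(1)
proof (induction n arbitrary: \<pi>)
  case 0
  then have "\<pi> = id" by simp
  then show ?case using zero by (simp only:)
next
  case (Suc n)
  have "{1..Suc n} = insert (Suc n) {1..n}" by auto
  then obtain a \<rho> where a: "a \<in> insert (Suc n) {1..n}" and \<rho>: "\<rho> permutes {1..n}"
    and \<pi>: "\<pi> = \<rho> \<circ> transpose a (Suc n)"
    using Suc.prems permutes_insert_decompose by metis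
  show ?case
  proof (cases "a = Suc n")
    case True
    then show ?thesis using fixed[OF \<rho> Suc.IH[OF \<rho>]] by (simp add: \<pi>)
  next
    case False
    then show ?thesis unfolding \<pi> using a by (intro moved \<rho> Suc.IH) simp
  qed
qed

lemma ex1_monotone_factorisation:
  assumes "\<pi> permutes {1..n}"
  shows "\<exists>!ts. monotone_factorisation n \<pi> ts"
  using assms
proof (induction rule: permutes_atLeastAtMost_induct)
  case zero
  have factorisation_iff: "monotone_factorisation 0 id ts \<longleftrightarrow> ts = []" for ts
    by (cases ts) (auto simp: monotone_factorisation_def strictly_monotone_def)
  show ?case unfolding factorisation_iff by simp
next
  case (fixed n \<pi>)
  then show ?case by (simp add: monotone_factorisation_Suc_fixed)
next
  case (moved n \<pi> a)
  then show ?case unfolding monotone_factorisation_Suc_moved[OF moved.hyps] by blast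
qed

lemma card_orbits_insert_fixed:
  assumes "finite A" "\<pi> permutes A" "N \<notin> A"
  shows "card (orbit \<pi> ` insert N A) = Suc (card (orbit \<pi> ` A))"
proof -
  have "orbit \<pi> N = {N}"
    using assms(2,3) by (simp add: orbit_eq_singleton_iff permutes_not_in)
  moreover have "{N} \<notin> orbit \<pi> ` A"
    using permutes_orbit_subset[OF assms(2)] assms(3) by fastforce
  ultimately show ?thesis using assms(1) by simp
qed

lemma orbit_comp_transpose:
  assumes "finite A" and \<pi>: "\<pi> permutes A" and "N \<notin> A" "a \<in> A" "x \<in> A"
  shows "orbit (\<pi> \<circ> transpose a N) x - {N} = orbit \<pi> x"
proof -
  let ?\<pi>' = "\<pi> \<circ> transpose a N"
  have subset: "orbit \<pi> x \<subseteq> A" using \<pi> \<open>x \<in> A\<close> by (rule permutes_orbit_subset)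
  have self: "x \<in> orbit \<pi> x"
    by (rule permutation_self_in_orbit) (rule permutes_imp_permutation[OF assms(1) \<pi>])
  have apply_eq: "?\<pi>' y = (if y = a then N else \<pi> y)" if "y \<in> A" for y
    using that assms(3) \<pi> by (auto simp: transpose_def permutes_not_in)
  have apply_N: "?\<pi>' N = \<pi> a" by simp
  have "(y = N \<and> a \<in> orbit \<pi> x) \<or> y \<in> orbit \<pi> x" if "y \<in> orbit ?\<pi>' x" for y
    using that
  proof induction
    case base
    show ?case using apply_eq[OF \<open>x \<in> A\<close>] self by (cases "x = a") (auto intro: orbit.base)
  next
    case (step y)
    then show ?case
      using apply_eq[of y] apply_N subset assms(3)
      by (cases "y = N"; cases "y = a") (auto intro: orbit.step)
  qed
  moreover have "y \<in> orbit ?\<pi>' x" if "y \<in> orbit \<pi> x" for y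
    using that
  proof induction
    case base
    show ?case using apply_eq[OF \<open>x \<in> A\<close>] apply_N by (metis orbit.base orbit.step)
  next
    case (step y)
    then show ?case using apply_eq[of y] apply_N subset by (metis orbit.step subsetD)
  qed
  ultimately show ?thesis using subset assms(3) by blast
qed

lemma card_orbits_comp_transpose:
  assumes "finite A" and \<pi>: "\<pi> permutes A" and "N \<notin> A" "a \<in> A"
  shows "card (orbit (\<pi> \<circ> transpose a N) ` insert N A) = card (orbit \<pi> ` A)"
proof -
  let ?\<pi>' = "\<pi> \<circ> transpose a N"
  have "?\<pi>' permutes insert N A"
    using assms by (intro permutes_compose permutes_swap_id) (auto intro: permutes_subset)
  then have perm: "permutation ?\<pi>'" using \<open>finite A\<close> by (intro permutes_imp_permutation) auto
  have orbit_eq: "orbit ?\<pi>' x - {N} = orbit \<pi> x" if "x \<in> A" for x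
    using assms that by (rule orbit_comp_transpose)
  have "?\<pi>' a = N" using assms(3) \<pi> by (simp add: permutes_not_in)
  then have "orbit ?\<pi>' N = orbit ?\<pi>' a" using permutation_orbit_step[OF perm, of a] by simp
  then have "orbit ?\<pi>' ` insert N A = orbit ?\<pi>' ` A" using \<open>a \<in> A\<close> by auto
  moreover have "orbit \<pi> ` A = (\<lambda>C. C - {N}) ` orbit ?\<pi>' ` A"
    by (simp add: image_image orbit_eq cong: image_cong)
  moreover have "inj_on (\<lambda>C. C - {N}) (orbit ?\<pi>' ` A)"
  proof (rule inj_onI, clarify)
    fix x y assume xy: "x \<in> A" "y \<in> A" "orbit ?\<pi>' x - {N} = orbit ?\<pi>' y - {N}"
    have "x \<in> orbit ?\<pi>' x - {N}"
      using permutation_self_in_orbit[OF perm] xy(1) assms(3) by blast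
    then show "orbit ?\<pi>' x = orbit ?\<pi>' y"
      using xy(3) by (simp add: orbit_eq_iff_mem[OF perm])
  qed
  ultimately show ?thesis by (simp add: card_image)
qed

lemma length_monotone_factorisation:
  assumes "monotone_factorisation n \<pi> ts"
  shows "length ts + card (orbit \<pi> ` {1..n}) = n"
  using monotone_factorisation_permutes[OF assms] assms
proof (induction arbitrary: ts rule: permutes_atLeastAtMost_induct)
  case zero
  then show ?case by (cases ts) (auto simp: monotone_factorisation_def)
next
  case (fixed n \<pi>)
  then show ?case
    using card_orbits_insert_fixed[of "{1..n}" \<pi> "Suc n"]
    by (simp add: monotone_factorisation_Suc_fixed atLeastAtMostSuc_conv)
next
  case (moved n \<pi> a)
  obtain us where us: "ts = us @ [(a, Suc n)]" "monotone_factorisation n \<pi> us"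
    using moved.prems unfolding monotone_factorisation_Suc_moved[OF moved.hyps] by blast
  have "{1..Suc n} = insert (Suc n) {1..n}" by auto
  then have card_orbits: "card (orbit (\<pi> \<circ> transpose a (Suc n)) ` {1..Suc n}) =
      card (orbit \<pi> ` {1..n})"
    using card_orbits_comp_transpose[OF _ moved.hyps(1) _ moved.hyps(2)] by simp
  show ?case unfolding card_orbits using moved.IH[OF us(2)] us(1) by simp
qed

lemma monotone_factorisation_mem_iff:
  assumes "monotone_factorisation n \<pi> ts" "\<pi> ` E = E" "(a, b) \<in> set ts"
  shows "a \<in> E \<longleftrightarrow> b \<in> E"
  using monotone_factorisation_permutes[OF assms(1)] assms
proof (induction arbitrary: ts rule: permutes_atLeastAtMost_induct)
  case zero
  then show ?case by (cases ts) (auto simp: monotone_factorisation_def)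
next
  case (fixed n \<pi>)
  then show ?case by (simp add: monotone_factorisation_Suc_fixed)
next
  case (moved n \<pi> c)
  let ?\<pi>' = "\<pi> \<circ> transpose c (Suc n)"
  obtain us where us: "ts = us @ [(c, Suc n)]" "monotone_factorisation n \<pi> us"
    using moved.prems(1) unfolding monotone_factorisation_Suc_moved[OF moved.hyps] by blast
  have "?\<pi>' c = Suc n" using moved.hyps by (simp add: permutes_not_in)
  moreover have "inj ?\<pi>'" using permutes_inj[OF moved.hyps(1)] by (simp add: inj_compose)
  ultimately have last: "c \<in> E \<longleftrightarrow> Suc n \<in> E" using moved.prems(2) by (metis inj_image_mem_iff)
  then have "transpose c (Suc n) ` E = E" by simp
  then have "\<pi> ` E = E" using moved.prems(2) by (metis image_comp)
  then show ?case using moved.IH[OF us(2)] moved.prems(3) us(1) last by auto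
qed

section \<open>Connected origamis by genus\<close>

definition genus_origamis :: "nat \<Rightarrow> nat \<Rightarrow> ((nat \<Rightarrow> nat) \<times> (nat \<Rightarrow> nat)) set" where
  "genus_origamis g n = {(\<sigma>, \<rho>). \<sigma> permutes {1..n} \<and> \<rho> permutes {1..n} \<and> irreducible_on {\<sigma>, \<rho>} {1..n}
    \<and> card (orbit (commutator \<sigma> \<rho>) ` {1..n}) + 2 * g = n + 2}"

lemma finite_partitions_of: "finite (partitions_of n)"
proof (rule finite_subset)
  show "partitions_of n \<subseteq> (\<Union>k\<le>n. multisets_of_size {1..n} k)"
  proof
    fix lam assume "lam \<in> partitions_of n"
    then have pos: "\<forall>x\<in>#lam. 0 < x" and sum: "sum_mset lam = n" by (auto simp: partitions_of_def)
    have "size lam \<le> sum_mset lam" using pos by (induction lam) auto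
    moreover have "x \<le> sum_mset lam" if "x \<in># lam" for x
      using that by (auto dest!: multi_member_split)
    ultimately show "lam \<in> (\<Union>k\<le>n. multisets_of_size {1..n} k)"
      using pos sum by (auto simp: multisets_of_size_def Suc_le_eq)
  qed
qed (simp add: finite_multisets_of_size)

lemma cycle_type_on_in_partitions_of:
  assumes "\<pi> permutes {1..n}"
  shows "cycle_type_on {1..n} \<pi> \<in> partitions_of n"
proof -
  have "permutation \<pi>" using assms by (intro permutes_imp_permutation) auto
  then have "0 < card (orbit \<pi> x)" for x
    using finite_orbit[OF permutation_self_in_orbit] orbit_nonempty by (metis card_gt_0_iff)
  then show ?thesis
    using sum_mset_cycle_type_on[OF _ assms] by (auto simp: partitions_of_def cycle_type_on_def)
qed

lemma H_eq_card_genus_origamis: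
  assumes "1 \<le> n"
  shows "H g n = card (genus_origamis g n) / fact n"
proof -
  let ?P = "{lam \<in> partitions_of n. int (size lam) = int n + 2 - 2 * int g}"
  have "H g n = (\<Sum>lam\<in>?P. card (connected_origamis {1..n} lam) / fact n)"
    unfolding H_def
  proof (rule sum.cong)
    fix lam assume "lam \<in> ?P"
    then have "sum_mset lam = n" by (simp add: partitions_of_def)
    then show "hcoef lam = card (connected_origamis {1..n} lam) / fact n"
      using hcoef_eq_connected_weight[of lam] assms by (simp add: connected_weight_def)
  qed simp
  also have "\<dots> = real (\<Sum>lam\<in>?P. card (connected_origamis {1..n} lam)) / fact n"
    by (simp add: sum_divide_distrib)
  also have "(\<Sum>lam\<in>?P. card (connected_origamis {1..n} lam)) =
      card (\<Union>lam\<in>?P. connected_origamis {1..n} lam)"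
  proof (rule card_UN_disjoint[symmetric])
    show "\<forall>lam\<in>?P. \<forall>\<mu>\<in>?P. lam \<noteq> \<mu> \<longrightarrow> connected_origamis {1..n} lam \<inter> connected_origamis {1..n} \<mu> = {}"
      by (auto simp: connected_origamis_def origamis_def)
  qed (simp_all add: finite_partitions_of finite_connected_origamis)
  also have "(\<Union>lam\<in>?P. connected_origamis {1..n} lam) = genus_origamis g n"
  proof -
    have "cycle_type_on {1..n} (commutator \<sigma> \<rho>) \<in> ?P \<longleftrightarrow>
        card (orbit (commutator \<sigma> \<rho>) ` {1..n}) + 2 * g = n + 2"
      if "\<sigma> permutes {1..n}" "\<rho> permutes {1..n}" for \<sigma> \<rho>
      using cycle_type_on_in_partitions_of[OF commutator_permutes[OF that]]
      by (auto simp: size_cycle_type_on)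
    then show ?thesis
      unfolding genus_origamis_def connected_origamis_def origamis_def by blast
  qed
  finally show ?thesis .
qed

lemma transitive_with_factors_iff_irreducible_on:
  assumes perm: "\<sigma> permutes {1..n}" "\<rho> permutes {1..n}"
    and ts: "monotone_factorisation n (inv (commutator \<sigma> \<rho>)) ts"
  shows "(\<forall>x\<in>{1..n}. \<forall>y\<in>{1..n}. \<exists>f\<in>gen_group ({\<sigma>, \<rho>} \<union> (\<lambda>(a, b). transpose a b) ` set ts). f x = y)
    \<longleftrightarrow> irreducible_on {\<sigma>, \<rho>} {1..n}"
proof -
  let ?T = "(\<lambda>(a, b). transpose a b) ` set ts"
  have "s permutes {1..n}" if "s \<in> {\<sigma>, \<rho>} \<union> ?T" for s
    using that perm ts by (auto simp: monotone_factorisation_def intro!: permutes_swap_id)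
  then have "(\<forall>x\<in>{1..n}. \<forall>y\<in>{1..n}. \<exists>f\<in>gen_group ({\<sigma>, \<rho>} \<union> ?T). f x = y) \<longleftrightarrow>
      irreducible_on ({\<sigma>, \<rho>} \<union> ?T) {1..n}"
    by (rule gen_group_transitive_iff_irreducible_on)
  also have "\<dots> \<longleftrightarrow> irreducible_on {\<sigma>, \<rho>} {1..n}"
  proof (rule irreducible_on_Un_eq)
    fix E assume "invariant_under {\<sigma>, \<rho>} E"
    then have "inv (commutator \<sigma> \<rho>) ` E = E"
      using perm by (intro gen_group_image_eq[OF gen_inv[OF commutator_in_gen_group]])
        (auto simp: permutes_bij)
    then have "transpose a b ` E = E" if "(a, b) \<in> set ts" for a b
      using monotone_factorisation_mem_iff[OF ts _ that] by simp
    then show "invariant_under ?T E" unfolding invariant_under_def by fast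
  qed
  finally show ?thesis .
qed

lemma Htilde_tuple_iff:
  assumes "1 \<le> g"
  shows "\<sigma> permutes {1..n} \<and> \<rho> permutes {1..n} \<and> length ts = 2 * g - 2
      \<and> (\<forall>(a, b)\<in>set ts. 1 \<le> a \<and> a < b \<and> b \<le> n) \<and> strictly_monotone ts
      \<and> commutator \<sigma> \<rho> \<circ> foldr (\<lambda>(a, b) f. transpose a b \<circ> f) ts id = id
      \<and> (\<forall>x\<in>{1..n}. \<forall>y\<in>{1..n}. \<exists>f\<in>gen_group ({\<sigma>, \<rho>} \<union> (\<lambda>(a, b). transpose a b) ` set ts). f x = y)
    \<longleftrightarrow> (\<sigma>, \<rho>) \<in> genus_origamis g n \<and> monotone_factorisation n (inv (commutator \<sigma> \<rho>)) ts"
proof (cases "\<sigma> permutes {1..n} \<and> \<rho> permutes {1..n}")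
  case True
  then have perm: "\<sigma> permutes {1..n}" "\<rho> permutes {1..n}" by auto
  let ?\<pi> = "commutator \<sigma> \<rho>"
  have \<pi>: "?\<pi> permutes {1..n}" using perm by (rule commutator_permutes)
  have "foldr (\<lambda>(a, b) f. transpose a b \<circ> f) ts id = apply_transps ts"
    by (induction ts) auto
  moreover have "?\<pi> \<circ> f = id \<longleftrightarrow> f = inv ?\<pi>" for f
    using permutes_inv_o[OF \<pi>] by (metis comp_id id_comp o_assoc)
  moreover have "length ts = 2 * g - 2 \<longleftrightarrow> card (orbit ?\<pi> ` {1..n}) + 2 * g = n + 2"
    if ts: "monotone_factorisation n (inv ?\<pi>) ts"
  proof -
    have "orbit (inv ?\<pi>) x = orbit ?\<pi> x" for x
      by (rule orbit_inv_eq) (rule permutes_imp_permutation[OF _ \<pi>], simp)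
    then show ?thesis using length_monotone_factorisation[OF ts] \<open>1 \<le> g\<close> by auto
  qed
  ultimately show ?thesis
    using transitive_with_factors_iff_irreducible_on[OF perm] perm
    unfolding monotone_factorisation_def genus_origamis_def by auto
qed (auto simp: genus_origamis_def)

lemma Htilde_eq_card_genus_origamis:
  assumes "1 \<le> g"
  shows "Htilde g n = card (genus_origamis g n) / fact n"
proof -
  define factorisation where
    "factorisation \<sigma> \<rho> = (THE ts. monotone_factorisation n (inv (commutator \<sigma> \<rho>)) ts)" for \<sigma> \<rho>
  have factorisation_iff:
    "monotone_factorisation n (inv (commutator \<sigma> \<rho>)) ts \<longleftrightarrow> ts = factorisation \<sigma> \<rho>"
    if "\<sigma> permutes {1..n}" "\<rho> permutes {1..n}" for \<sigma> \<rho> ts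
    using ex1_monotone_factorisation[OF permutes_inv[OF commutator_permutes[OF that]]]
    unfolding factorisation_def by (metis (no_types, lifting) theI')
  have "Htilde g n = card {(\<sigma>, \<rho>, ts). (\<sigma>, \<rho>) \<in> genus_origamis g n
      \<and> monotone_factorisation n (inv (commutator \<sigma> \<rho>)) ts} / fact n"
    unfolding Htilde_def by (simp only: Htilde_tuple_iff[OF assms])
  also have "{(\<sigma>, \<rho>, ts). (\<sigma>, \<rho>) \<in> genus_origamis g n
      \<and> monotone_factorisation n (inv (commutator \<sigma> \<rho>)) ts}
      = (\<lambda>(\<sigma>, \<rho>). (\<sigma>, \<rho>, factorisation \<sigma> \<rho>)) ` genus_origamis g n"
    by (auto simp: factorisation_iff genus_origamis_def)
  also have "card \<dots> = card (genus_origamis g n)"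
    by (rule card_image) (auto intro: inj_onI)
  finally show ?thesis .
qed

theorem mainTheorem7:
  fixes g n :: nat
  assumes "1 \<le> g" and "1 \<le> n"
  shows "Htilde g n = H g n"
  using assms by (simp add: Htilde_eq_card_genus_origamis H_eq_card_genus_origamis)

end
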